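(* Let $(X,d)$ be a metric space, $\mu$ a Borel probability measure on $X$ and $T\colon X\to X$ a $\mu$-preserving transformation. Suppose $\mu$ satisfies condition (A). Let $(B_i)_{i\ge0}$ be balls in $X$ such that, for some $\beta>0$ and $\gamma>1$, \[ \mu(B_i)\ge i^{-1}(\log i)^{\beta-1}(\log\log i)(\log\log\log i)^{\gamma}\quad\text{for all sufficiently large } i. \] If $(T,X,\mu,d)$ has $\beta^{-1}$-exponential decay of correlations, then \[ \frac{\sum_{i=0}^{n-1}1_{B_i}(T^ix)}{\sum_{i=0}^{n-1}\mu(B_i)}\to1\quad\text{as } n\to\infty,\ \text{for } \mu\text{-a.e. } x\in X. \]
   Context: Condition (A): there exist $C>0$, $0<\delta<2$ and $r_0>0$ such that for all $x_0\in X$, $0<r\le r_0$ and $0<\epsilon\le1$, $\mu(\{x: r<d(x,x_0)<r+\epsilon\})<C\epsilon^{\delta}$. Convention: if the $B_i=B(x_0,r_i)$ are nested balls with $r_i\to0$, all centered at one given point $x_0$, then this inequality is only required for that point $x_0$. For $s>0$, $(T,X,\mu,d)$ has $s$-exponential decay of correlations if there are constants $C,\alpha>0$ such that for all Lipschitz functions $\varphi,\psi\colon X\to\mathbb{R}$ and all $n\ge1$, $\left|\int\varphi\circ T^n\,\psi\,d\mu-\int\varphi\,d\mu\int\psi\,d\mu\right|\le c(n)\|\varphi\|_{\mathrm{Lip}}\|\psi\|_{\mathrm{Lip}}$ with $c(n)\le Ce^{-\alpha n^{s}}$, where $\|\cdot\|_{\mathrm{Lip}}$ is the usual Lipschitz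 norm (supremum norm plus least Lipschitz constant).
   Formalization: The radii of the balls are additionally assumed to be eventually at most the r_0 of condition (A) (automatic for nested balls with r_i → 0); without this the claim fails, since (A) says nothing about the boundaries of balls of larger radius. *)

theory Defs
  imports "HOL-Probability.Probability"
begin

definition measure_preserving_map :: "'a measure \<Rightarrow> ('a \<Rightarrow> 'a) \<Rightarrow> bool" where
  "measure_preserving_map M T \<longleftrightarrow> T \<in> measurable M M \<and> distr M M T = M"

text \<open>
  The points at which the annulus estimate below is required: every point in general, but only the
  common centre when the balls are nested and concentric with radii tending to 0.
\<close>

definition required_centres :: "(nat \<Rightarrow> 'a::metric_space) \<Rightarrow> (nat \<Rightarrow> real) \<Rightarrow> 'a set" where
  "required_centres c r =
     (if (\<forall>i. c i = c 0) \<and> decseq (\<lambda>i. ball (c i) (r i)) \<and> r \<longlonglongrightarrow> 0 then {c 0} else UNIV)"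

text \<open>
  The scale \<open>r0\<close> is kept as a parameter, because the radii of the balls have to be compared with it.
\<close>

definition condition_A :: "'a::metric_space measure \<Rightarrow> 'a set \<Rightarrow> real \<Rightarrow> bool" where
  "condition_A M S r0 \<longleftrightarrow> 0 < r0 \<and>
     (\<exists>C>0. \<exists>\<delta>>0. \<delta> < 2 \<and>
        (\<forall>x0\<in>S. \<forall>r \<epsilon>. 0 < r \<and> r \<le> r0 \<and> 0 < \<epsilon> \<and> \<epsilon> \<le> 1 \<longrightarrow>
           measure M {x. r < dist x x0 \<and> dist x x0 < r + \<epsilon>} < C * \<epsilon> powr \<delta>))"

text \<open>
  Functions of finite Lipschitz norm; for an unbounded function the supremum norm is infinite, so
  that a bound by the product of the norms says nothing about it.
\<close>

definition lip_functions :: "('a::metric_space \<Rightarrow> real) set" where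
  "lip_functions = {f. bounded (range f) \<and> (\<exists>L. L-lipschitz_on UNIV f)}"

definition lip_norm :: "('a::metric_space \<Rightarrow> real) \<Rightarrow> real" where
  "lip_norm f = (SUP x. \<bar>f x\<bar>) + Inf {L. L-lipschitz_on UNIV f}"

definition exp_decay_of_correlations ::
    "('a::metric_space \<Rightarrow> 'a) \<Rightarrow> 'a measure \<Rightarrow> real \<Rightarrow> bool" where
  "exp_decay_of_correlations T M s \<longleftrightarrow>
     (\<exists>c :: nat \<Rightarrow> real. \<exists>C>0. \<exists>\<alpha>>0.
        (\<forall>n\<ge>1. c n \<le> C * exp (- \<alpha> * real n powr s)) \<and>
        (\<forall>\<phi>\<in>lip_functions. \<forall>\<psi>\<in>lip_functions. \<forall>n\<ge>1.
           \<bar>(\<integral>x. \<phi> ((T ^^ n) x) * \<psi> x \<partial>M) - (\<integral>x. \<phi> x \<partial>M) * (\<integral>x. \<psi> x \<partial>M)\<bar>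
             \<le> c n * lip_norm \<phi> * lip_norm \<psi>))"

end

theory Submission
  imports Defs "HOL-Real_Asymp.Real_Asymp"
begin

text \<open>
  Let \<open>E\<^sub>n\<close> be the sum of the measures of the first \<open>n\<close> balls and \<open>S\<^sub>n\<close> the number of visits. An upper bound
  on the variance of \<open>S\<^sub>n\<close> needs only upper bounds on correlations, so it suffices to replace the
  indicators by Lipschitz functions lying above them; condition (A) bounds the error. With bumps of width
  a power of \<open>1 / n\<close>, pairs of times more than \<open>K (ln n)\<^sup>\<beta>\<close> apart contribute \<open>O(1)\<close> in total,
  and the remaining pairs contribute \<open>O(E\<^sub>n (ln n)\<^sup>\<beta>)\<close>. Along times at which \<open>E\<close> passes \<open>q\<^sup>k\<close>,
  Chebyshev's inequality bounds the probability of a relative error of \<open>q - 1\<close> by a multiple of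
  \<open>(ln n)\<^sup>\<beta> / E\<^sub>n\<close>, which by the growth hypothesis is of order \<open>q\<^sup>-\<^sup>k\<^sup>/\<^sup>2 + 1 / (k (ln k)\<^sup>\<gamma>)\<close>, a summable
  sequence. Borel-Cantelli, monotonicity of \<open>S\<close> and \<open>E\<close> between these times, and \<open>q \<rightarrow> 1\<close> finish the proof.
\<close>

section \<open>A strong law from variance bounds\<close>

text \<open>Chebyshev's inequality at the first times \<open>N k\<close> with
  \<open>E \<ge> q ^ k\<close> bounds the probability of a relative error of \<open>q - 1\<close> by
  a summable sequence, so by Borel-Cantelli almost every point has only finitely many such errors.
  Between \<open>N k\<close> and \<open>N (Suc k)\<close> both \<open>S\<close> and \<open>E\<close>
  are monotone, which costs a further factor close to \<open>q\<close> on either side.\<close>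

lemma (in prob_space) geometric_subsequence_bounds:
  fixes A :: "nat \<Rightarrow> 'a set" and \<rho> :: "real \<Rightarrow> real" and y0 q :: real
  defines "E \<equiv> \<lambda>n. \<Sum>i<n. prob (A i)"
    and "S \<equiv> \<lambda>n x. \<Sum>i<n. indicat_real (A i) x"
  assumes A [measurable]: "\<And>i. A i \<in> events"
    and div: "filterlim E at_top sequentially"
    and var: "\<forall>\<^sub>F n in sequentially. variance (S n) \<le> \<rho> (E n) * (E n)\<^sup>2"
    and mono: "antimono_on {y0..} \<rho>"
    and q: "1 < q" and summable: "summable (\<lambda>k. \<rho> (q ^ k))"
  shows "AE x in M. \<forall>\<^sub>F n in sequentially.
           (2 - q) / q \<le> S n x / E n \<and> S n x / E n \<le> q * (2 * q - 1)"
proof -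
  have exp_S: "expectation (S n) = E n" for n
    unfolding S_def E_def by (subst Bochner_Integration.integral_sum) (auto simp: less_top[symmetric])
  have S_meas [measurable]: "S n \<in> borel_measurable M" for n
    unfolding S_def by measurable
  have S_bound: "\<bar>S n x\<bar> \<le> real n" for n x
  proof -
    have "\<bar>S n x\<bar> \<le> (\<Sum>i<n. \<bar>indicat_real (A i) x\<bar>)"
      unfolding S_def by (rule sum_abs)
    also have "\<dots> \<le> (\<Sum>i<n. 1)" by (intro sum_mono) (auto simp: indicator_def)
    finally show ?thesis by simp
  qed
  have S_int: "integrable M (\<lambda>x. (S n x)\<^sup>2)" for n
  proof (rule integrable_const_bound[where B="(real n)\<^sup>2"])
    show "AE x in M. norm ((S n x)\<^sup>2) \<le> (real n)\<^sup>2"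
    proof (rule AE_I2)
      fix x assume "x \<in> space M"
      have "\<bar>S n x\<bar> \<le> \<bar>real n\<bar>" using S_bound[of n x] by simp
      hence "(S n x)\<^sup>2 \<le> (real n)\<^sup>2" by (simp only: abs_le_square_iff)
      thus "norm ((S n x)\<^sup>2) \<le> (real n)\<^sup>2" by simp
    qed
  qed measurable
  have E_mono: "E m \<le> E n" if "m \<le> n" for m n
    unfolding E_def using that by (intro sum_mono2) auto
  have S_mono: "S m x \<le> S n x" if "m \<le> n" for m n x
    unfolding S_def using that by (intro sum_mono2) auto
  have E_Suc: "E (Suc n) \<le> E n + 1" for n
    unfolding E_def by simp
  define N where "N k = (LEAST n. E n \<ge> q ^ k)" for k
  have ex: "\<exists>n. E n \<ge> q ^ k" for k
    using div by (auto simp: filterlim_at_top eventually_sequentially)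
  have N: "E (N k) \<ge> q ^ k" for k
    unfolding N_def using ex by (rule LeastI_ex)
  have N_le: "N k \<le> n" if "E n \<ge> q ^ k" for k n
    unfolding N_def using that by (rule Least_le)
  have N_upper: "E (N k) \<le> q ^ k + 1" for k
  proof (cases "N k")
    case 0
    have "q ^ k > 0" using q by simp
    with 0 show ?thesis by (simp add: E_def)
  next
    case (Suc m)
    hence "\<not> E m \<ge> q ^ k" using N_le[of k m] by auto
    \<comment> \<open>Just before \<open>N k\<close> the sum is below \<open>q ^ k\<close>, and one
      further probability adds at most 1.\<close>
    thus ?thesis using E_Suc[of m] Suc by simp
  qed
  have E_le: "E n \<le> real n" for n
  proof -
    have "E n \<le> (\<Sum>i<n. 1)" unfolding E_def by (intro sum_mono) auto
    thus ?thesis by simp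
  qed
  have pow_lim: "filterlim (\<lambda>k. q ^ k) at_top sequentially"
    using q by real_asymp
  have N_lim: "filterlim N at_top sequentially"
  proof -
    have "filterlim (\<lambda>k. real (N k)) at_top sequentially"
      by (rule filterlim_at_top_mono[OF pow_lim]) (intro always_eventually allI order_trans[OF N E_le])
    thus ?thesis using filterlim_sequentially_iff_filterlim_real by blast
  qed
  \<comment> \<open>Tying the tolerated relative error to \<open>q\<close> makes both final bounds
    tend to 1 as \<open>q\<close> tends to 1.\<close>
  define \<eta> where "\<eta> = q - 1"
  have \<eta>: "\<eta> > 0" using q by (simp add: \<eta>_def)
  define D where "D k = {x \<in> space M. \<eta> * E (N k) \<le> \<bar>S (N k) x - E (N k)\<bar>}" for k
  have D_meas [measurable]: "D k \<in> events" for k unfolding D_def by measurable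
  have D_prob: "\<forall>\<^sub>F k in sequentially. prob (D k) \<le> \<rho> (q ^ k) / \<eta>\<^sup>2"
  proof -
    have "\<forall>\<^sub>F k in sequentially. variance (S (N k)) \<le> \<rho> (E (N k)) * (E (N k))\<^sup>2"
      using N_lim var by (auto simp: filterlim_iff)
    moreover have "\<forall>\<^sub>F k in sequentially. q ^ k \<ge> y0"
      using pow_lim by (auto simp: filterlim_at_top)
    ultimately show ?thesis
    proof eventually_elim
      case (elim k)
      have qk: "q ^ k > 0" using q by simp
      hence Epos: "E (N k) > 0" using N[of k] by linarith
      have "prob (D k) \<le> variance (S (N k)) / (\<eta> * E (N k))\<^sup>2"
        unfolding D_def using Chebyshev_inequality[OF S_meas S_int, of "\<eta> * E (N k)" "N k"] \<eta> Epos
        by (simp add: exp_S)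
      also have "\<dots> \<le> (\<rho> (E (N k)) * (E (N k))\<^sup>2) / (\<eta> * E (N k))\<^sup>2"
        using elim by (intro divide_right_mono) auto
      also have "\<dots> = \<rho> (E (N k)) / \<eta>\<^sup>2"
        using Epos by (simp add: power_mult_distrib)
      \<comment> \<open>The value \<open>E (N k)\<close> is only known to lie above
        \<open>q ^ k\<close>; monotonicity of \<open>\<rho>\<close> replaces it by the explicit
        point at which summability is assumed.\<close>
      also have "\<dots> \<le> \<rho> (q ^ k) / \<eta>\<^sup>2"
        using mono N[of k] elim by (intro divide_right_mono) (auto simp: monotone_on_def)
      finally show ?case .
    qed
  qed
  have "summable (\<lambda>k. prob (D k))"
    using summable_divide[OF summable, of "\<eta>\<^sup>2"]
    by (rule summable_comparison_test_ev[rotated]) (use D_prob in \<open>auto elim: eventually_mono\<close>)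
  hence "AE x in M. \<forall>\<^sub>F k in sequentially. x \<in> space M - D k"
    by (intro borel_cantelli_AE1) (auto simp: less_top[symmetric])
  thus ?thesis
  proof (rule AE_mp, intro AE_I2 impI)
    fix x assume "x \<in> space M" and ev: "\<forall>\<^sub>F k in sequentially. x \<in> space M - D k"
    \<comment> \<open>From here on the overshoot of at most 1 in \<open>E (N k)\<close> is itself a
      relative error of at most \<open>\<eta>\<close>.\<close>
    have "\<forall>\<^sub>F k in sequentially. 1 / \<eta> \<le> q ^ k"
      using pow_lim by (auto simp: filterlim_at_top)
    with ev obtain K where K: "\<And>k. k \<ge> K \<Longrightarrow> x \<notin> D k" "\<And>k. k \<ge> K \<Longrightarrow> 1 / \<eta> \<le> q ^ k"
      unfolding eventually_sequentially by (metis DiffD2 nle_le order_trans)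
    have near: "\<bar>S (N k) x - E (N k)\<bar> < \<eta> * E (N k)" if "k \<ge> K" for k
      using K(1)[OF that] \<open>x \<in> space M\<close> by (auto simp: D_def)
    have "\<forall>\<^sub>F n in sequentially. E n \<ge> q ^ K"
      using div by (auto simp: filterlim_at_top)
    thus "\<forall>\<^sub>F n in sequentially. (2 - q) / q \<le> S n x / E n \<and> S n x / E n \<le> q * (2 * q - 1)"
    proof eventually_elim
      case (elim n)
      have "\<forall>\<^sub>F k in sequentially. E n < q ^ k"
        using pow_lim by (auto simp: filterlim_at_top_dense)
      then obtain k' where k': "E n < q ^ k'" by (auto simp: eventually_sequentially)
      have bd: "\<forall>k. q ^ k \<le> E n \<longrightarrow> k \<le> k'"
        using k' q by (auto dest: le_less_trans[of _ "E n"])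
      \<comment> \<open>This is the index with \<open>q ^ k \<le> E n < q ^ Suc k\<close>, which
        places \<open>n\<close> between \<open>N k\<close> and \<open>N (Suc k)\<close>.\<close>
      define k where "k = Greatest (\<lambda>k. q ^ k \<le> E n)"
      have k: "q ^ k \<le> E n" unfolding k_def by (rule GreatestI_nat[where b=k' and P="\<lambda>k. q ^ k \<le> E n", OF elim bd[rule_format]])
      have "K \<le> k" unfolding k_def by (rule Greatest_le_nat[where b=k' and P="\<lambda>k. q ^ k \<le> E n", OF elim bd[rule_format]])
      have k_Suc: "E n < q ^ Suc k"
      proof (rule ccontr)
        assume "\<not> ?thesis"
        hence "q ^ Suc k \<le> E n" by simp
        hence "Suc k \<le> k" unfolding k_def by (rule Greatest_le_nat[where b=k' and P="\<lambda>k. q ^ k \<le> E n", OF _ bd[rule_format]])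
        thus False by simp
      qed
      have "N k \<le> n" using k by (rule N_le)
      have "n \<le> N (Suc k)"
        using E_mono[of "N (Suc k)" n] N[of "Suc k"] k_Suc by linarith
      have qk: "q ^ k > 0" using q by simp
      have Epos: "E n > 0" using qk k by linarith
      have one: "1 \<le> \<eta> * q ^ k" using K(2)[OF \<open>K \<le> k\<close>] \<eta> by (simp add: field_simps)
      show ?case
      proof
        have Slow: "(2 - q) * E (N k) \<le> S n x"
          using near[OF \<open>K \<le> k\<close>] S_mono[OF \<open>N k \<le> n\<close>, of x] by (simp add: \<eta>_def algebra_simps abs_if split: if_splits)
        have S0: "0 \<le> S n x" unfolding S_def by (intro sum_nonneg) auto
        show "(2 - q) / q \<le> S n x / E n"
        \<comment> \<open>Multiplying by \<open>2 - q\<close> preserves inequalities only if it is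
          nonnegative; for larger \<open>q\<close> the claimed lower bound is negative and hence
          trivial.\<close>
        proof (cases "q \<le> 2")
          case True
          have "(2 - q) * E n \<le> (2 - q) * (q * q ^ k)"
            using k_Suc True by (intro mult_left_mono) auto
          also have "\<dots> = q * ((2 - q) * q ^ k)" by simp
          also have "\<dots> \<le> q * ((2 - q) * E (N k))"
            using N[of k] True q by (intro mult_left_mono) auto
          also have "\<dots> \<le> q * S n x" using Slow q by (intro mult_left_mono) auto
          finally show ?thesis using Epos q by (simp add: field_simps)
        next
          case False
          hence "(2 - q) / q \<le> 0" using q by (simp add: divide_nonpos_pos)
          also have "0 \<le> S n x / E n" using S0 Epos by simp
          finally show ?thesis .
        qed
        have "S n x \<le> S (N (Suc k)) x" using \<open>n \<le> N (Suc k)\<close> by (rule S_mono)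
        also have "\<dots> \<le> q * E (N (Suc k))"
          using near[of "Suc k"] \<open>K \<le> k\<close> by (simp add: \<eta>_def algebra_simps abs_if split: if_splits)
        also have "\<dots> \<le> q * (q * q ^ k + 1)"
          using N_upper[of "Suc k"] q by (intro mult_left_mono) auto
        also have "\<dots> \<le> q * (q * q ^ k + (q - 1) * q ^ k)"
          using one q unfolding \<eta>_def by (intro mult_left_mono add_mono) auto
        also have "\<dots> = q * (2 * q - 1) * q ^ k" by (simp add: algebra_simps)
        also have "\<dots> \<le> q * (2 * q - 1) * E n"
          using k q by (intro mult_left_mono) auto
        finally show "S n x / E n \<le> q * (2 * q - 1)"
          using Epos by (simp add: field_simps)
      qed
    qed
  qed
qed

text \<open>Both bounds along geometric times tend to 1 as \<open>q\<close> tends to 1. Countably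
  many values of \<open>q\<close> suffice, so the exceptional null sets can be united.\<close>

lemma (in prob_space) strong_law_of_variance_bound:
  fixes A :: "nat \<Rightarrow> 'a set" and \<rho> :: "real \<Rightarrow> real" and y0 :: real
  defines "E \<equiv> \<lambda>n. \<Sum>i<n. prob (A i)"
    and "S \<equiv> \<lambda>n x. \<Sum>i<n. indicat_real (A i) x"
  assumes A: "\<And>i. A i \<in> events"
    and div: "filterlim E at_top sequentially"
    and var: "\<forall>\<^sub>F n in sequentially. variance (S n) \<le> \<rho> (E n) * (E n)\<^sup>2"
    and mono: "antimono_on {y0..} \<rho>"
    and summable: "\<And>q. 1 < q \<Longrightarrow> summable (\<lambda>k. \<rho> (q ^ k))"
  shows "AE x in M. (\<lambda>n. S n x / E n) \<longlonglongrightarrow> 1"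
proof -
  define q where "q m = 1 + 1 / real (Suc m)" for m
  have "AE x in M. \<forall>m. \<forall>\<^sub>F n in sequentially.
           (2 - q m) / q m \<le> S n x / E n \<and> S n x / E n \<le> q m * (2 * q m - 1)"
    unfolding AE_all_countable
  proof
    fix m
    have "1 < q m" by (simp add: q_def)
    thus "AE x in M. \<forall>\<^sub>F n in sequentially.
           (2 - q m) / q m \<le> S n x / E n \<and> S n x / E n \<le> q m * (2 * q m - 1)"
      using geometric_subsequence_bounds[OF A div[unfolded E_def] var[unfolded E_def S_def] mono _ summable]
      unfolding E_def S_def by blast
  qed
  thus ?thesis
  proof (rule AE_mp, intro AE_I2 impI)
    fix x assume *: "\<forall>m. \<forall>\<^sub>F n in sequentially.
           (2 - q m) / q m \<le> S n x / E n \<and> S n x / E n \<le> q m * (2 * q m - 1)"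
    have lower: "(\<lambda>m. (2 - q m) / q m) \<longlonglongrightarrow> 1" and upper: "(\<lambda>m. q m * (2 * q m - 1)) \<longlonglongrightarrow> 1"
      unfolding q_def by real_asymp+
    show "(\<lambda>n. S n x / E n) \<longlonglongrightarrow> 1"
    proof (rule order_tendstoI)
      fix a :: real assume "a < 1"
      with lower have "\<forall>\<^sub>F m in sequentially. a < (2 - q m) / q m" by (rule order_tendstoD)
      then obtain m where "a < (2 - q m) / q m" by (auto simp: eventually_sequentially)
      with *[rule_format, of m] show "\<forall>\<^sub>F n in sequentially. a < S n x / E n"
        by (auto elim: eventually_mono)
    next
      fix a :: real assume "1 < a"
      with upper have "\<forall>\<^sub>F m in sequentially. q m * (2 * q m - 1) < a" by (rule order_tendstoD)
      then obtain m where "q m * (2 * q m - 1) < a" by (auto simp: eventually_sequentially)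
      with *[rule_format, of m] show "\<forall>\<^sub>F n in sequentially. S n x / E n < a"
        by (auto elim: eventually_mono)
    qed
  qed
qed

section \<open>Growth of the sums of measures\<close>

text \<open>Cauchy condensation turns the series into one dominated by a multiple of the sum of
  \<open>n powr (- \<gamma>)\<close>. The shift \<open>+ 1\<close> keeps the logarithm positive at
  1; otherwise that term would be 0 by division by zero and the terms would not be
  decreasing.\<close>

lemma summable_Bertrand:
  fixes \<gamma> :: real
  assumes "1 < \<gamma>"
  shows "summable (\<lambda>n. 1 / (real n * ln (real n + 1) powr \<gamma>))"
proof (subst condensation_test)
  show "1 / (real (Suc m) * ln (real (Suc m) + 1) powr \<gamma>) \<le> 1 / (real m * ln (real m + 1) powr \<gamma>)"
    if "0 < m" for m
    using that assms by (intro divide_left_mono mult_mono powr_mono2 mult_pos_pos) auto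
  show "summable (\<lambda>n. 2 ^ n * (1 / (real (2 ^ n) * ln (real (2 ^ n) + 1) powr \<gamma>)))"
  proof (rule summable_comparison_test_ev)
    show "summable (\<lambda>n. inverse (ln 2 powr \<gamma>) * real n powr (- \<gamma>))"
      using assms by (intro summable_mult) (simp add: summable_real_powr_iff)
    show "\<forall>\<^sub>F n in sequentially. norm (2 ^ n * (1 / (real (2 ^ n) * ln (real (2 ^ n) + 1) powr \<gamma>)))
        \<le> inverse (ln 2 powr \<gamma>) * real n powr (- \<gamma>)"
      using eventually_gt_at_top[of 0]
    proof eventually_elim
      case (elim n)
      have "(ln 2 * real n) powr \<gamma> \<le> ln (real (2 ^ n) + 1) powr \<gamma>"
      proof (intro powr_mono2)
        have "ln 2 * real n = ln (2 ^ n)" by (simp add: ln_realpow)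
        also have "\<dots> \<le> ln (real (2 ^ n) + 1)" by (subst ln_le_cancel_iff) (auto simp: add_pos_pos)
        finally show "ln 2 * real n \<le> ln (real (2 ^ n) + 1)" .
      qed (use assms in auto)
      moreover have "(ln 2 * real n) powr \<gamma> > 0" using elim by simp
      ultimately have "1 / ln (real (2 ^ n) + 1) powr \<gamma> \<le> 1 / (ln 2 * real n) powr \<gamma>"
        by (intro divide_left_mono mult_pos_pos) auto
      thus ?case by (simp add: powr_mult powr_minus field_simps)
    qed
  qed
qed auto

text \<open>At \<open>y = q ^ k\<close> the first summand is geometric and the second, since
  \<open>ln y = k * ln q\<close>, is comparable to a term of the Bertrand series.\<close>

definition chebyshev_rate :: "real \<Rightarrow> real \<Rightarrow> real" where
  "chebyshev_rate \<gamma> y = y powr (- 1 / 2) + 1 / (ln y * ln (ln y) powr \<gamma>)"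

text \<open>From \<open>exp 2\<close> on, \<open>ln y \<ge> 2\<close>, so both \<open>ln y\<close>
  and \<open>ln (ln y)\<close> are positive and increasing.\<close>

lemma antimono_chebyshev_rate:
  assumes "0 < \<gamma>"
  shows "antimono_on {exp 2..} (chebyshev_rate \<gamma>)"
proof (rule monotone_onI)
  fix x y :: real assume xy: "x \<in> {exp 2..}" "y \<in> {exp 2..}" "x \<le> y"
  have x: "0 < x" using xy by (auto intro: less_le_trans[OF exp_gt_zero])
  have lx: "2 \<le> ln x" using xy x by (simp add: ln_ge_iff)
  have lxy: "ln x \<le> ln y" using xy x by simp
  have llx: "0 < ln (ln x)" using lx by simp
  have llxy: "ln (ln x) \<le> ln (ln y)" using lxy lx by simp
  show "chebyshev_rate \<gamma> y \<le> chebyshev_rate \<gamma> x"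
    unfolding chebyshev_rate_def
  proof (intro add_mono)
    show "y powr (- 1 / 2) \<le> x powr (- 1 / 2)" using x xy by (intro powr_mono2') auto
    have "ln x * ln (ln x) powr \<gamma> \<le> ln y * ln (ln y) powr \<gamma>"
      using lx lxy llx llxy assms by (intro mult_mono powr_mono2) auto
    moreover have "0 < ln x * ln (ln x) powr \<gamma>" using lx llx by (intro mult_pos_pos) auto
    ultimately show "1 / (ln y * ln (ln y) powr \<gamma>) \<le> 1 / (ln x * ln (ln x) powr \<gamma>)"
      by (rule frac_le[OF zero_le_one order_refl, rotated])
  qed
qed

lemma summable_chebyshev_rate:
  assumes "1 < \<gamma>" "1 < q"
  shows "summable (\<lambda>k. chebyshev_rate \<gamma> (q ^ k))"
  unfolding chebyshev_rate_def
proof (rule summable_add)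
  have "(q ^ k) powr (- 1 / 2) = (q powr (- 1 / 2)) ^ k" for k
    using assms by (simp add: powr_realpow[symmetric] powr_powr mult.commute)
  moreover have "q powr (- 1 / 2) < 1" using assms by (simp add: powr_less_one)
  ultimately show "summable (\<lambda>k. (q ^ k) powr (- 1 / 2))"
    by (simp add: summable_geometric_iff)
  have lq: "0 < ln q" using assms by simp
  have g0: "0 < \<gamma>" using assms by simp
  \<comment> \<open>Halving the logarithm absorbs the constant \<open>ln (ln q)\<close>, which is
    negative for \<open>q\<close> close to 1.\<close>
  have ev: "\<forall>\<^sub>F k in sequentially. ln (real k + 1) / 2 \<le> ln (real k * ln q)"
    using lq by real_asymp
  show "summable (\<lambda>k. 1 / (ln (q ^ k) * ln (ln (q ^ k)) powr \<gamma>))"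
  proof (rule summable_comparison_test_ev)
    show "summable (\<lambda>k. (2 powr \<gamma> / ln q) * (1 / (real k * ln (real k + 1) powr \<gamma>)))"
      by (intro summable_mult summable_Bertrand assms)
    show "\<forall>\<^sub>F k in sequentially. norm (1 / (ln (q ^ k) * ln (ln (q ^ k)) powr \<gamma>))
       \<le> (2 powr \<gamma> / ln q) * (1 / (real k * ln (real k + 1) powr \<gamma>))"
      using ev eventually_gt_at_top[of 0]
    proof eventually_elim
      case (elim k)
      have l1: "0 < ln (real k + 1)" using elim by simp
      have "(ln (real k + 1) / 2) powr \<gamma> \<le> ln (real k * ln q) powr \<gamma>"
        using elim l1 g0 by (intro powr_mono2) auto
      moreover have pos: "0 < (ln (real k + 1) / 2) powr \<gamma>" using l1 by simp
      ultimately have "1 / (real k * ln q * ln (real k * ln q) powr \<gamma>)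
          \<le> 1 / (real k * ln q * (ln (real k + 1) / 2) powr \<gamma>)"
        using lq elim by (intro divide_left_mono mult_left_mono mult_pos_pos) auto
      also have "\<dots> = (2 powr \<gamma> / ln q) * (1 / (real k * ln (real k + 1) powr \<gamma>))"
        using l1 lq elim by (simp add: powr_divide)
      finally show ?case using lq elim by (simp add: ln_realpow)
    qed
  qed
qed

text \<open>
  Either \<open>(ln n)\<^sup>\<beta> \<le> \<surd>E\<close>, and the first summand of the rate suffices, or \<open>ln E \<le> 2 \<beta> ln (ln n)\<close>,
  and the growth hypothesis yields the second summand.
\<close>
lemma growth_imp_chebyshev_rate:
  fixes E :: "nat \<Rightarrow> real"
  assumes "0 < \<beta>" "0 < \<gamma>" "0 < a"
    and E: "filterlim E at_top sequentially"
    and growth: "\<forall>\<^sub>F n in sequentially.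
      a * ln (real n) powr \<beta> * ln (ln (real n)) * ln (ln (ln (real n))) powr \<gamma> \<le> E n"
  obtains C where "0 < C"
    "\<forall>\<^sub>F n in sequentially. ln (real n) powr \<beta> \<le> C * chebyshev_rate \<gamma> (E n) * E n"
proof
  \<comment> \<open>The summand 1 serves the case of large \<open>E\<close>. In the other case
    \<open>2 * \<beta>\<close> comes from \<open>ln E \<le> 2 * \<beta> * ln (ln n)\<close>,
    \<open>2 powr \<gamma>\<close> from the halved iterated logarithm, and \<open>a\<close> from the
    growth bound.\<close>
  define C where "C = 1 + 2 * \<beta> * 2 powr \<gamma> / a"
  show "0 < C" using assms by (simp add: C_def add_pos_nonneg)
  have "\<forall>\<^sub>F y in at_top. ln (ln y) / 2 \<le> ln (ln y / (2 * \<beta>))"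
    using assms(1) by real_asymp
  hence ev1: "\<forall>\<^sub>F n in sequentially. ln (ln (E n)) / 2 \<le> ln (ln (E n) / (2 * \<beta>))"
    using E by (rule eventually_compose_filterlim)
  have ev2: "\<forall>\<^sub>F n in sequentially. exp 2 \<le> E n" 
    using E by (auto simp: filterlim_at_top)
  have ev3: "\<forall>\<^sub>F n::nat in sequentially. 1 < ln (ln (real n))" by real_asymp
  show "\<forall>\<^sub>F n in sequentially. ln (real n) powr \<beta> \<le> C * chebyshev_rate \<gamma> (E n) * E n"
    using ev1 ev2 ev3 growth
  proof eventually_elim
    case (elim n)
    define y u where "y = E n" and "u = ln (real n)"
    have y: "0 < y" "1 < y" using elim(2) unfolding y_def
      by (auto intro: less_le_trans[OF exp_gt_zero] less_le_trans[of 1 "exp 2"])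
    have ly: "2 \<le> ln y" using elim(2) y unfolding y_def by (simp add: ln_ge_iff)
    have lly: "0 < ln (ln y)" using ly by simp
    have lu: "1 < ln u" using elim(3) by (simp add: u_def)
    have u: "0 < u"
    proof (rule ccontr)
      assume "\<not> 0 < u"
      moreover have "u \<ge> 0" unfolding u_def by (cases n) auto
      ultimately show False using lu by simp
    qed
    have gr: "a * u powr \<beta> * ln u * ln (ln u) powr \<gamma> \<le> y"
      using elim(4) by (simp add: y_def u_def)
    have rate0: "0 \<le> 1 / (ln y * ln (ln y) powr \<gamma>)" using ly by simp
    have C1: "1 \<le> C" using assms by (simp add: C_def)
    have "u powr \<beta> \<le> C * chebyshev_rate \<gamma> y * y"
    proof (cases "u powr \<beta> \<le> y powr (1 / 2)")
      case True
      have "y powr (1 / 2) = y powr (- 1 / 2) * y"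
        using y powr_add[of y "- 1 / 2" 1] by simp
      also have "\<dots> \<le> chebyshev_rate \<gamma> y * y"
        using rate0 y by (intro mult_right_mono) (auto simp: chebyshev_rate_def)
      also have "\<dots> \<le> C * (chebyshev_rate \<gamma> y * y)"
        using C1 y rate0 mult_right_mono[of 1 C "chebyshev_rate \<gamma> y * y"] by (simp add: chebyshev_rate_def)
      finally show ?thesis using True by simp
    next
      case False
      \<comment> \<open>Taking logarithms here bounds \<open>ln y\<close> by a multiple of
        \<open>ln u\<close>, so the iterated logarithms of \<open>n\<close> in the growth bound can
        be traded for logarithms of \<open>E\<close>.\<close>
      have "ln (y powr (1 / 2)) < ln (u powr \<beta>)" using False y u by (subst ln_less_cancel_iff) auto
      hence lyu: "ln y / (2 * \<beta>) < ln u" using y u assms(1) by (simp add: ln_powr field_simps)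
      have "ln (ln y) / 2 \<le> ln (ln y / (2 * \<beta>))" using elim(1) by (simp add: y_def)
      also have "\<dots> \<le> ln (ln u)" using lyu ly lu assms(1) by (subst ln_le_cancel_iff) auto
      finally have llyu: "ln (ln y) / 2 \<le> ln (ln u)" .
      have "a * u powr \<beta> * ((ln y / (2 * \<beta>)) * (ln (ln y) / 2) powr \<gamma>)
          \<le> a * u powr \<beta> * (ln u * ln (ln u) powr \<gamma>)"
        using lyu llyu lly lu ly assms by (intro mult_left_mono mult_mono powr_mono2) auto
      also have "\<dots> \<le> y" using gr by (simp add: mult.assoc)
      finally have "u powr \<beta> \<le> (2 * \<beta> * 2 powr \<gamma> / a) * (1 / (ln y * ln (ln y) powr \<gamma>)) * y"
        using ly lly assms by (simp add: powr_divide field_simps)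
      also have "\<dots> \<le> C * chebyshev_rate \<gamma> y * y"
        using y rate0 assms C1 by (intro mult_mono mult_nonneg_nonneg) (auto simp: C_def chebyshev_rate_def)
      finally show ?thesis .
    qed
    thus ?case by (simp add: y_def u_def)
  qed
qed

section \<open>Lower bounds for the sum of the measures of the balls\<close>

lemma sum_inverse_ge_ln:
  assumes "0 < m" "m \<le> n"
  shows "ln (real n) - ln (real m) \<le> (\<Sum>i=m..<n. inverse (real i))"
  using assms(2)
proof (induction n rule: dec_induct)
  case (step n)
  \<comment> \<open>One step of the telescoping sum, by \<open>ln x \<le> x - 1\<close>.\<close>
  have "ln (real (Suc n) / real n) \<le> real (Suc n) / real n - 1"
    using step assms by (intro ln_le_minus_one) auto
  also have "\<dots> = inverse (real n)" using step assms by (simp add: field_simps)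
  finally show ?case using step assms by (simp add: ln_div)
qed auto

text \<open>Only the indices from about \<open>sqrt n\<close> to \<open>n\<close> are summed. There
  \<open>ln i\<close> lies between \<open>ln n / 2\<close> and \<open>ln n\<close>, so every
  logarithmic factor is comparable to its value at \<open>n\<close>, and the remaining harmonic sum
  supplies the missing factor \<open>ln n\<close>.\<close>

lemma sum_log_growth:
  fixes p :: "nat \<Rightarrow> real"
  assumes "0 < \<gamma>" and p0: "\<And>i. 0 \<le> p i"
    and p: "\<forall>\<^sub>F i in sequentially.
      inverse (real i) * ln (real i) powr (\<beta> - 1) * ln (ln (real i)) * ln (ln (ln (real i))) powr \<gamma> \<le> p i"
  obtains a where "0 < a" "\<forall>\<^sub>F n in sequentially.
      a * ln (real n) powr \<beta> * ln (ln (real n)) * ln (ln (ln (real n))) powr \<gamma> \<le> (\<Sum>i<n. p i)"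
proof
  \<comment> \<open>With \<open>u = ln n\<close> and \<open>v = ln i\<close>, this makes
    \<open>b * u powr (\<beta> - 1) \<le> v powr (\<beta> - 1)\<close> hold for either sign of the
    exponent: \<open>v \<ge> u / 2\<close> is used if \<open>\<beta> \<ge> 1\<close>, and
    \<open>v \<le> u\<close> otherwise.\<close>
  define b where "b = min 1 ((1/2) powr (\<beta> - 1))"
  \<comment> \<open>The halves are lost in the two iterated logarithms, the third in the harmonic
    sum.\<close>
  define a where "a = b * (1/2) * (1/2) powr \<gamma> / 3"
  have b: "0 < b" by (simp add: b_def)
  thus "0 < a" by (simp add: a_def)
  obtain i0 where i0: "\<And>i. i \<ge> i0 \<Longrightarrow> inverse (real i) * ln (real i) powr (\<beta> - 1) * ln (ln (real i))
      * ln (ln (ln (real i))) powr \<gamma> \<le> p i"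
    using p by (auto simp: eventually_sequentially)
  define s where "s n = nat \<lceil>sqrt (real n)\<rceil>" for n
  have e1: "\<forall>\<^sub>F n::nat in sequentially. real i0 \<le> sqrt (real n)" by real_asymp
  \<comment> \<open>An exponent above 1/2 leaves room for rounding \<open>sqrt n\<close> up; the
    harmonic sum is then still at least \<open>ln n / 3\<close>.\<close>
  have e2: "\<forall>\<^sub>F n::nat in sequentially. sqrt (real n) + 1 \<le> real n powr (2/3)" by real_asymp
  have e3: "\<forall>\<^sub>F n::nat in sequentially. ln (ln (real n)) / 2 \<le> ln (ln (real n) / 2)" by real_asymp
  have e4: "\<forall>\<^sub>F n::nat in sequentially. ln (ln (ln (real n))) / 2 \<le> ln (ln (ln (real n)) / 2)" by real_asymp
  have e5: "\<forall>\<^sub>F n::nat in sequentially. 1 < ln (ln (ln (real n)))" by real_asymp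
  have e6: "\<forall>\<^sub>F n::nat in sequentially. 1 < ln (ln (real n))" by real_asymp
  have e7: "\<forall>\<^sub>F n::nat in sequentially. 2 < ln (real n)" by real_asymp
  have e8: "\<forall>\<^sub>F n::nat in sequentially. real n powr (2/3) \<le> real n" by real_asymp
  show "\<forall>\<^sub>F n in sequentially.
      a * ln (real n) powr \<beta> * ln (ln (real n)) * ln (ln (ln (real n))) powr \<gamma> \<le> (\<Sum>i<n. p i)"
    using e1 e2 e3 e4 e5 e6 e7 e8 eventually_ge_at_top[of 1]
  proof eventually_elim
    case (elim n)
    define u where "u = ln (real n)"
    have u: "2 < u" "1 < ln u" "1 < ln (ln u)" using elim by (auto simp: u_def)
    have sq: "1 \<le> sqrt (real n)" using elim by simp
    have s_ge: "sqrt (real n) \<le> real (s n)" unfolding s_def by linarith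
    have s_le: "real (s n) \<le> sqrt (real n) + 1" unfolding s_def using sq by linarith
    have s1: "0 < s n" using s_ge sq by linarith
    have sn: "s n \<le> n" using s_le elim by linarith
    have si0: "i0 \<le> s n" using s_ge elim by linarith
    have pi: "b * u powr (\<beta> - 1) * (ln u / 2) * (ln (ln u) / 2) powr \<gamma> * inverse (real i) \<le> p i"
      if i: "i \<in> {s n..<n}" for i
    proof -
      define v where "v = ln (real i)"
      have i1: "sqrt (real n) \<le> real i" "1 \<le> real i" "real i \<le> real n" using i s_ge s1 by auto
      have "u / 2 = ln (sqrt (real n))" using elim by (simp add: u_def ln_sqrt)
      also have "\<dots> \<le> v" unfolding v_def using i1 sq by (subst ln_le_cancel_iff) linarith+
      finally have v1: "u / 2 \<le> v" .
      have v2: "v \<le> u" unfolding u_def v_def using i1 by (subst ln_le_cancel_iff) auto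
      have v0: "0 < v" using v1 u by simp
      have lv: "ln u / 2 \<le> ln v"
      proof -
        have "ln u / 2 \<le> ln (u / 2)" using elim by (simp add: u_def)
        also have "\<dots> \<le> ln v" using v1 u by simp
        finally show ?thesis .
      qed
      have llv: "ln (ln u) / 2 \<le> ln (ln v)"
      proof -
        have "ln (ln u) / 2 \<le> ln (ln u / 2)" using elim by (simp add: u_def)
        also have "\<dots> \<le> ln (ln v)" using lv u by simp
        finally show ?thesis .
      qed
      have bv: "b * u powr (\<beta> - 1) \<le> v powr (\<beta> - 1)"
      proof (cases "\<beta> \<ge> 1")
        case True
        have "b * u powr (\<beta> - 1) \<le> (1/2) powr (\<beta> - 1) * u powr (\<beta> - 1)"
          by (intro mult_right_mono) (auto simp: b_def)
        also have "\<dots> = (u / 2) powr (\<beta> - 1)" using u by (simp add: powr_divide)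
        also have "\<dots> \<le> v powr (\<beta> - 1)" using True v1 u by (intro powr_mono2) auto
        finally show ?thesis .
      next
        case False
        have "b * u powr (\<beta> - 1) \<le> 1 * u powr (\<beta> - 1)"
          by (intro mult_right_mono) (auto simp: b_def)
        also have "\<dots> \<le> v powr (\<beta> - 1)" using False v2 v0 by (simp add: powr_mono2')
        finally show ?thesis .
      qed
      have "b * u powr (\<beta> - 1) * (ln u / 2) * (ln (ln u) / 2) powr \<gamma> \<le>
          v powr (\<beta> - 1) * ln v * ln (ln v) powr \<gamma>"
        using bv lv llv u b v0 v1 assms(1) by (intro mult_mono powr_mono2 mult_nonneg_nonneg) auto
      hence "inverse (real i) * (b * u powr (\<beta> - 1) * (ln u / 2) * (ln (ln u) / 2) powr \<gamma>) \<le>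
          inverse (real i) * (v powr (\<beta> - 1) * ln v * ln (ln v) powr \<gamma>)"
        by (intro mult_left_mono) auto
      also have "\<dots> \<le> p i" using i0[of i] i si0 by (simp add: v_def mult_ac)
      finally show ?thesis by (simp add: mult_ac)
    qed
    have "u / 3 \<le> ln (real n) - ln (real (s n))"
    proof -
      have "ln (real (s n)) \<le> ln (real n powr (2/3))"
        using s_le elim s1 by (subst ln_le_cancel_iff) auto
      also have "\<dots> = 2/3 * u" using elim by (simp add: u_def ln_powr)
      finally show ?thesis by (simp add: u_def)
    qed
    also have "\<dots> \<le> (\<Sum>i=s n..<n. inverse (real i))" using s1 sn by (rule sum_inverse_ge_ln)
    finally have harm: "u / 3 \<le> (\<Sum>i=s n..<n. inverse (real i))" .
    have "a * u powr \<beta> * ln u * ln (ln u) powr \<gamma>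
        = (b * u powr (\<beta> - 1) * (ln u / 2) * (ln (ln u) / 2) powr \<gamma>) * (u / 3)"
      using u powr_add[of u "\<beta> - 1" 1] by (simp add: a_def powr_divide field_simps)
    also have "\<dots> \<le> (b * u powr (\<beta> - 1) * (ln u / 2) * (ln (ln u) / 2) powr \<gamma>) * (\<Sum>i=s n..<n. inverse (real i))"
      using harm b u by (intro mult_left_mono) auto
    also have "\<dots> = (\<Sum>i=s n..<n. b * u powr (\<beta> - 1) * (ln u / 2) * (ln (ln u) / 2) powr \<gamma> * inverse (real i))"
      by (simp add: sum_distrib_left)
    also have "\<dots> \<le> (\<Sum>i=s n..<n. p i)" by (intro sum_mono pi)
    also have "\<dots> \<le> (\<Sum>i<n. p i)" by (intro sum_mono2) (auto simp: p0)
    finally show ?case by (simp add: u_def)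
  qed
qed

section \<open>Variance and correlations\<close>

text \<open>The variance is the double sum of covariances. A far pair contributes at most
  \<open>\<kappa>\<close>; a near pair contributes at most the probability of the event with the
  larger index, and each index is the larger one in at most \<open>i0 + m\<close> near pairs. The
  factor 2 accounts for both orders of a pair. The initial segment below \<open>i0\<close> is
  treated as near so that \<open>corr\<close> is required only later.\<close>

lemma (in prob_space) variance_sum_indicator_le:
  fixes A :: "nat \<Rightarrow> 'a set" and \<kappa> :: real
  assumes A [measurable]: "\<And>i. A i \<in> events" and \<kappa>: "0 \<le> \<kappa>"
    and corr: "\<And>i j. i0 \<le> i \<Longrightarrow> i + m \<le> j \<Longrightarrow> j < n \<Longrightarrow>
      prob (A i \<inter> A j) \<le> prob (A i) * prob (A j) + \<kappa>"
  shows "variance (\<lambda>x. \<Sum>i<n. indicat_real (A i) x)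
    \<le> 2 * real (i0 + m) * (\<Sum>i<n. prob (A i)) + (real n)\<^sup>2 * \<kappa>"
proof -
  define p where "p i = prob (A i)" for i
  define near where "near i j \<longleftrightarrow> i \<le> j \<and> (i < i0 \<or> j < i + m)" for i j
  define t where "t i j = (if near i j then p j else 0)" for i j
  have t0: "0 \<le> t i j" for i j by (simp add: t_def p_def)
  have ind_int: "integrable M (indicat_real (A i))" for i
    by (auto simp: less_top[symmetric])
  have ind2_int: "integrable M (indicat_real (A i \<inter> A j))" for i j
    by (auto simp: less_top[symmetric])
  have sq: "(\<Sum>i<n. indicat_real (A i) x)\<^sup>2 = (\<Sum>i<n. \<Sum>j<n. indicat_real (A i \<inter> A j) x)" for x
    by (simp add: power2_eq_square sum_product indicator_inter_arith)
  have "variance (\<lambda>x. \<Sum>i<n. indicat_real (A i) x)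
      = expectation (\<lambda>x. (\<Sum>i<n. indicat_real (A i) x)\<^sup>2) - (expectation (\<lambda>x. \<Sum>i<n. indicat_real (A i) x))\<^sup>2"
    by (rule variance_eq) (auto simp: sq intro!: Bochner_Integration.integrable_sum ind_int ind2_int)
  moreover have "expectation (\<lambda>x. (\<Sum>i<n. indicat_real (A i) x)\<^sup>2) = (\<Sum>i<n. \<Sum>j<n. prob (A i \<inter> A j))"
    unfolding sq by (subst Bochner_Integration.integral_sum | intro Bochner_Integration.integrable_sum ind2_int sum.cong refl)+ auto
  moreover have "expectation (\<lambda>x. \<Sum>i<n. indicat_real (A i) x) = (\<Sum>i<n. p i)"
    by (subst Bochner_Integration.integral_sum) (auto simp: p_def intro: ind_int)
  moreover have "(\<Sum>i<n. \<Sum>j<n. prob (A i \<inter> A j)) - (\<Sum>i<n. p i)\<^sup>2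
      = (\<Sum>i<n. \<Sum>j<n. prob (A i \<inter> A j) - p i * p j)"
    by (simp add: power2_eq_square sum_product sum_subtractf)
  ultimately have "variance (\<lambda>x. \<Sum>i<n. indicat_real (A i) x)
      = (\<Sum>i<n. \<Sum>j<n. prob (A i \<inter> A j) - p i * p j)" by simp
  \<comment> \<open>\<open>t\<close> vanishes unless its first index is at most its second, so one
    of the two terms covers each order; counting the diagonal twice is harmless for an upper
    bound.\<close>
  also have "\<dots> \<le> (\<Sum>i<n. \<Sum>j<n. t i j + t j i + \<kappa>)"
  proof (intro sum_mono)
    fix i j assume ij: "i \<in> {..<n}" "j \<in> {..<n}"
    have *: "prob (A i \<inter> A j) - p i * p j \<le> t i j + \<kappa>" if "i \<le> j" "j < n" for i j
    proof (cases "near i j")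
      case True
      have "prob (A i \<inter> A j) \<le> p j" unfolding p_def by (rule finite_measure_mono) auto
      moreover have "0 \<le> p i * p j" by (simp add: p_def)
      ultimately show ?thesis using True \<kappa> unfolding t_def by simp
    next
      case False
      hence "i0 \<le> i" "i + m \<le> j" using that by (auto simp: near_def)
      thus ?thesis using corr[of i j] that t0[of i j] by (simp add: p_def)
    qed
    show "prob (A i \<inter> A j) - p i * p j \<le> t i j + t j i + \<kappa>"
    proof (cases "i \<le> j")
      case True
      thus ?thesis using *[of i j] ij t0[of j i] by simp
    next
      case False
      thus ?thesis using *[of j i] ij t0[of i j] by (simp add: Int_commute mult.commute)
    qed
  qed
  also have "\<dots> = (\<Sum>i<n. \<Sum>j<n. t i j) + (\<Sum>i<n. \<Sum>j<n. t j i) + (real n)\<^sup>2 * \<kappa>"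
    by (simp add: sum.distrib power2_eq_square)
  also have "(\<Sum>i<n. \<Sum>j<n. t i j) = (\<Sum>i<n. \<Sum>j<n. t j i)" by (rule sum.swap)
  also have "(\<Sum>i<n. \<Sum>j<n. t j i) \<le> real (i0 + m) * (\<Sum>i<n. p i)"
    unfolding sum_distrib_left
  proof (rule sum_mono)
    fix j
    have "{i. near i j} \<subseteq> {..<i0} \<union> {Suc j - m..<Suc j}" by (auto simp: near_def)
    hence "card {i. near i j} \<le> card ({..<i0} \<union> {Suc j - m..<Suc j})"
      by (intro card_mono) auto
    also have "\<dots> \<le> i0 + m" by (rule order_trans[OF card_Un_le]) auto
    finally have card: "card {i. near i j} \<le> i0 + m" .
    have "(\<Sum>i<n. t i j) = (\<Sum>i\<in>{i\<in>{..<n}. near i j}. p j)"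
      unfolding t_def by (rule sum.inter_filter[symmetric]) simp
    also have "\<dots> = real (card {i\<in>{..<n}. near i j}) * p j" by simp
    also have "card {i\<in>{..<n}. near i j} \<le> card {i. near i j}"
      by (rule card_mono) (auto simp: near_def intro: finite_subset[of _ "{..j}"])
    also note card
    finally show "(\<Sum>i<n. t i j) \<le> real (i0 + m) * p j" by (simp add: p_def mult_right_mono)
  qed
  finally show ?thesis by (simp add: p_def algebra_simps)
qed

section \<open>Lipschitz majorants of indicators of balls\<close>

lemma lip_norm_nonneg:
  assumes "f \<in> lip_functions"
  shows "0 \<le> lip_norm f"
proof -
  have "0 \<le> (SUP x. \<bar>f x\<bar>)"
  proof -
    have "bdd_above (range (\<lambda>x. \<bar>f x\<bar>))"
      using assms by (auto simp: lip_functions_def bounded_iff bdd_above_def)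
    thus ?thesis by (intro order_trans[OF _ cSUP_upper[of undefined UNIV]]) auto
  qed
  moreover have "0 \<le> Inf {L. L-lipschitz_on UNIV f}"
    using assms by (intro cInf_greatest) (auto simp: lip_functions_def lipschitz_on_def)
  ultimately show ?thesis by (simp add: lip_norm_def)
qed

text \<open>For positive \<open>\<epsilon>\<close>, a cut-off that is 1 up to distance
  \<open>r\<close> from \<open>c\<close> and falls linearly to 0 at distance
  \<open>r + \<epsilon>\<close>; it thus lies above the indicator of the ball.\<close>

definition bump :: "'a::metric_space \<Rightarrow> real \<Rightarrow> real \<Rightarrow> 'a \<Rightarrow> real" where
  "bump c r \<epsilon> x = max 0 (min 1 (1 + (r - dist x c) / \<epsilon>))"

lemma bump_range: "0 \<le> bump c r \<epsilon> x" "bump c r \<epsilon> x \<le> 1"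
  by (auto simp: bump_def)

lemma bump_eq_1: "0 < \<epsilon> \<Longrightarrow> x \<in> ball c r \<Longrightarrow> bump c r \<epsilon> x = 1"
  by (auto simp: bump_def dist_commute min_def max_def field_simps)

lemma bump_eq_0: "0 < \<epsilon> \<Longrightarrow> r + \<epsilon> \<le> dist x c \<Longrightarrow> bump c r \<epsilon> x = 0"
  by (auto simp: bump_def min_def max_def field_simps)

text \<open>Truncation to values between 0 and 1 does not increase differences, and the distance to
  \<open>c\<close> is 1-Lipschitz.\<close>

lemma lipschitz_bump:
  assumes "0 < \<epsilon>"
  shows "(1 / \<epsilon>)-lipschitz_on UNIV (bump c r \<epsilon>)"
proof (rule lipschitz_onI)
  fix x y
  have "dist (bump c r \<epsilon> x) (bump c r \<epsilon> y) \<le> \<bar>(r - dist x c) / \<epsilon> - (r - dist y c) / \<epsilon>\<bar>"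
    by (auto simp: bump_def dist_real_def)
  also have "\<dots> = \<bar>dist y c - dist x c\<bar> / \<epsilon>"
    using assms by (simp add: diff_divide_distrib[symmetric])
  also have "\<dots> \<le> dist x y / \<epsilon>"
    using assms abs_dist_diff_le[of y c x] by (intro divide_right_mono) (auto simp: dist_commute)
  finally show "dist (bump c r \<epsilon> x) (bump c r \<epsilon> y) \<le> 1 / \<epsilon> * dist x y" by simp
qed (use assms in auto)

lemma bump_in_lip_functions: "0 < \<epsilon> \<Longrightarrow> bump c r \<epsilon> \<in> lip_functions"
  unfolding lip_functions_def bounded_iff
  using lipschitz_bump[of \<epsilon> c r] by (intro CollectI conjI exI[of _ 1] exI[of _ "1 / \<epsilon>"]) (auto simp: bump_range)

lemma lip_norm_bump_le:
  assumes "0 < \<epsilon>"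
  shows "lip_norm (bump c r \<epsilon>) \<le> 1 + 1 / \<epsilon>"
  unfolding lip_norm_def
proof (rule add_mono)
  show "(SUP x. \<bar>bump c r \<epsilon> x\<bar>) \<le> 1"
    by (rule cSUP_least) (auto simp: bump_range)
  show "Inf {L. L-lipschitz_on UNIV (bump c r \<epsilon>)} \<le> 1 / \<epsilon>"
    using lipschitz_bump[OF assms] by (intro cInf_lower bdd_belowI[of _ 0]) (auto simp: lipschitz_on_def)
qed

lemma bump_measurable: "0 < \<epsilon> \<Longrightarrow> bump c r \<epsilon> \<in> borel_measurable borel"
  by (rule borel_measurable_continuous_onI) (rule lipschitz_on_continuous_on[OF lipschitz_bump])

text \<open>
  The bump exceeds the indicator of the ball on the half-closed annulus \<open>r \<le> dist x c < r + \<epsilon>\<close>; an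
  open annulus of twice the width that starts slightly inside the ball also covers the sphere.
\<close>
lemma integral_bump_le:
  fixes \<mu> :: "'a::metric_space measure"
  assumes "prob_space \<mu>" and sets: "sets \<mu> = sets borel"
    and "0 < r" "r \<le> r0" and \<epsilon>: "0 < \<epsilon>"
    and annulus: "\<And>s. 0 < s \<Longrightarrow> s \<le> r0 \<Longrightarrow> measure \<mu> {x. s < dist x c \<and> dist x c < s + 2 * \<epsilon>} \<le> e"
  shows "(\<integral>x. bump c r \<epsilon> x \<partial>\<mu>) \<le> measure \<mu> (ball c r) + e"
proof -
  interpret prob_space \<mu> by fact
  \<comment> \<open>Moving inwards by at most \<open>\<epsilon>\<close> keeps
    \<open>r + \<epsilon>\<close> within reach of the doubled width; the cap \<open>r / 2\<close>
    keeps the inner radius positive.\<close>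
  define s where "s = r - min \<epsilon> (r / 2)"
  define R where "R = {x. s < dist x c \<and> dist x c < s + 2 * \<epsilon>}"
  have s: "0 < s" "s \<le> r0" "s < r" "r + \<epsilon> \<le> s + 2 * \<epsilon>"
    using assms by (auto simp: s_def min_def)
  have "open R" unfolding R_def by (intro open_Collect_conj open_Collect_less continuous_intros)
  hence R [measurable]: "R \<in> sets \<mu>" using sets by simp
  have ball [measurable]: "ball c r \<in> sets \<mu>" using sets by simp
  have bump [measurable]: "bump c r \<epsilon> \<in> borel_measurable \<mu>"
    using bump_measurable[OF \<epsilon>] by (simp cong: measurable_cong_sets add: sets)
  have le: "bump c r \<epsilon> x \<le> indicat_real (ball c r) x + indicat_real R x" for x
  proof -
    consider "x \<in> ball c r" | "r + \<epsilon> \<le> dist x c" | "x \<in> R"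
      using s unfolding R_def by (force simp: dist_commute)
    thus ?thesis
      using bump_range[of c r \<epsilon> x] bump_eq_0[OF \<epsilon>, of r x c] by cases (auto simp: indicator_def)
  qed
  have "(\<integral>x. bump c r \<epsilon> x \<partial>\<mu>) \<le> (\<integral>x. indicat_real (ball c r) x + indicat_real R x \<partial>\<mu>)"
  proof (rule integral_mono)
    show "integrable \<mu> (bump c r \<epsilon>)"
      by (rule integrable_const_bound[where B=1]) (auto simp: bump_range)
    show "integrable \<mu> (\<lambda>x. indicat_real (ball c r) x + indicat_real R x)"
      by (auto simp: less_top[symmetric])
  qed (rule le)
  also have "\<dots> = measure \<mu> (ball c r) + measure \<mu> R"
    by (subst Bochner_Integration.integral_add) (auto simp: less_top[symmetric])
  also have "measure \<mu> R \<le> e" unfolding R_def using annulus s by blast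
  finally show ?thesis by simp
qed

section \<open>From decay of correlations to the variance of the number of visits\<close>

lemma measure_preserving_map_funpow:
  assumes "measure_preserving_map M T"
  shows "measure_preserving_map M (T ^^ n)"
proof (induction n)
  case 0
  show ?case by (simp add: measure_preserving_map_def id_def)
next
  case (Suc n)
  have "distr M M (T \<circ> T ^^ n) = distr (distr M M (T ^^ n)) M T"
    using assms Suc by (intro distr_distr[symmetric]) (auto simp: measure_preserving_map_def)
  thus ?case using assms Suc
    by (simp only: measure_preserving_map_def funpow.simps(2)) (auto intro: measurable_comp)
qed

lemma measure_preserving_map_vimage:
  assumes "measure_preserving_map M T" "A \<in> sets M"
  shows "measure M (T -` A \<inter> space M) = measure M A"
  using assms measure_distr[of T M M A] by (simp add: measure_preserving_map_def)

text \<open>The indicators are replaced by bumps, to which decay applies with Lipschitz norms of at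
  most \<open>1 + 1 / \<epsilon>\<close>. Returning from the integrals of the bumps to the measures
  of the balls costs \<open>e\<close> in each factor, hence \<open>2 * e + e\<^sup>2\<close> in the
  product. Here \<open>T\<close> stands for an iterate of the dynamics.\<close>

lemma correlation_balls_le:
  fixes \<mu> :: "'a::metric_space measure"
  assumes "prob_space \<mu>" and sets: "sets \<mu> = sets borel"
    and T: "T \<in> measurable \<mu> \<mu>"
    and r: "0 < r" "r \<le> r0" and s: "0 < s" "s \<le> r0" and \<epsilon>: "0 < \<epsilon>" and "0 \<le> D"
    and annulus: "\<And>z s. z \<in> {x, y} \<Longrightarrow> 0 < s \<Longrightarrow> s \<le> r0 \<Longrightarrow>
      measure \<mu> {w. s < dist w z \<and> dist w z < s + 2 * \<epsilon>} \<le> e"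
    and decay: "\<And>\<phi> \<psi>. \<phi> \<in> lip_functions \<Longrightarrow> \<psi> \<in> lip_functions \<Longrightarrow>
      \<bar>(\<integral>w. \<phi> (T w) * \<psi> w \<partial>\<mu>) - (\<integral>w. \<phi> w \<partial>\<mu>) * (\<integral>w. \<psi> w \<partial>\<mu>)\<bar> \<le> D * lip_norm \<phi> * lip_norm \<psi>"
  shows "measure \<mu> (ball x r \<inter> T -` ball y s)
    \<le> measure \<mu> (ball x r) * measure \<mu> (ball y s) + (2 * e + e\<^sup>2 + D * (1 + 1 / \<epsilon>)\<^sup>2)"
proof -
  interpret prob_space \<mu> by fact
  have space: "space \<mu> = UNIV" using sets_eq_imp_space_eq[OF sets] by simp
  have "0 \<le> e" using annulus[of x r] r measure_nonneg order_trans by blast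
  define f g where "f = bump x r \<epsilon>" and "g = bump y s \<epsilon>"
  have ranges: "0 \<le> f w" "f w \<le> 1" "0 \<le> g w" "g w \<le> 1" for w
    by (auto simp: f_def g_def bump_range)
  have [measurable]: "f \<in> borel_measurable \<mu>" "g \<in> borel_measurable \<mu>"
    unfolding f_def g_def using bump_measurable[OF \<epsilon>] by (simp_all cong: measurable_cong_sets add: sets)
  note T [measurable]
  have [measurable]: "ball x r \<in> sets \<mu>" "ball y s \<in> sets \<mu>" using sets by auto
  define A where "A = ball x r \<inter> T -` ball y s"
  have A [measurable]: "A \<in> sets \<mu>"
    using measurable_sets[OF T, of "ball y s"] by (auto simp: A_def space)
  have "measure \<mu> A = (\<integral>w. indicat_real A w \<partial>\<mu>)" by simp
  also have "\<dots> \<le> (\<integral>w. g (T w) * f w \<partial>\<mu>)"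
  proof (rule integral_mono)
    show "integrable \<mu> (indicat_real A)" by (auto simp: less_top[symmetric])
    show "integrable \<mu> (\<lambda>w. g (T w) * f w)"
      by (rule integrable_const_bound[where B=1]) (auto simp: ranges abs_mult mult_le_one)
    show "indicat_real A w \<le> g (T w) * f w" for w
      using bump_eq_1[OF \<epsilon>, of w x r] bump_eq_1[OF \<epsilon>, of "T w" y s]
      by (simp add: A_def indicator_def f_def g_def bump_range)
  qed
  also have "\<dots> \<le> (\<integral>w. g w \<partial>\<mu>) * (\<integral>w. f w \<partial>\<mu>) + D * lip_norm g * lip_norm f"
    using decay[of g f] bump_in_lip_functions[OF \<epsilon>] unfolding f_def g_def by force
  also have "D * lip_norm g * lip_norm f \<le> D * (1 + 1 / \<epsilon>) * (1 + 1 / \<epsilon>)"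
    unfolding f_def g_def using \<epsilon> \<open>0 \<le> D\<close>
    by (intro mult_mono lip_norm_bump_le mult_nonneg_nonneg lip_norm_nonneg bump_in_lip_functions) auto
  also have "(\<integral>w. g w \<partial>\<mu>) * (\<integral>w. f w \<partial>\<mu>) \<le> (measure \<mu> (ball y s) + e) * (measure \<mu> (ball x r) + e)"
    unfolding f_def g_def using \<open>0 \<le> e\<close>
    by (intro mult_mono integral_bump_le[where ?r0.0=r0, OF \<open>prob_space \<mu>\<close> sets _ _ \<epsilon>] r s annulus integral_nonneg_AE)
      (auto simp: bump_range)
  also have "\<dots> = measure \<mu> (ball x r) * measure \<mu> (ball y s)
      + e * (measure \<mu> (ball y s) + measure \<mu> (ball x r)) + e\<^sup>2"
    by (simp add: algebra_simps power2_eq_square)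
  also have "e * (measure \<mu> (ball y s) + measure \<mu> (ball x r)) \<le> e * 2"
    using \<open>0 \<le> e\<close> by (intro mult_left_mono) (auto intro: order_trans[OF add_mono[OF prob_le_1 prob_le_1]])
  finally show ?thesis by (simp add: A_def power2_eq_square mult_ac)
qed

text \<open>Bump width and time gap are chosen depending on \<open>n\<close> so that each far pair
  has error \<open>O(1 / n\<^sup>2)\<close>. The at most \<open>n\<^sup>2\<close> far pairs then
  contribute a constant, and the near pairs contribute the gap times \<open>E n\<close>.\<close>

lemma variance_visits_le:
  fixes \<mu> :: "'a::metric_space measure" and T :: "'a \<Rightarrow> 'a"
    and c :: "nat \<Rightarrow> 'a" and r :: "nat \<Rightarrow> real" and r0 \<beta> :: real
  defines "A \<equiv> \<lambda>i. (T ^^ i) -` ball (c i) (r i)"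
    and "E \<equiv> \<lambda>n. \<Sum>i<n. measure \<mu> (ball (c i) (r i))"
  assumes "prob_space \<mu>"
    and sets: "sets \<mu> = sets borel"
    and T: "measure_preserving_map \<mu> T"
    and r: "\<And>i. 0 < r i" "\<forall>\<^sub>F i in sequentially. r i \<le> r0"
    and cond_A: "condition_A \<mu> Z r0" and c: "\<And>i. c i \<in> Z"
    and \<beta>: "0 < \<beta>"
    and decay: "exp_decay_of_correlations T \<mu> (inverse \<beta>)"
    and E: "filterlim E at_top sequentially"
  obtains V where "0 < V"
    "\<forall>\<^sub>F n in sequentially. prob_space.variance \<mu> (\<lambda>x. \<Sum>i<n. indicat_real (A i) x)
      \<le> V * ln (real n) powr \<beta> * E n"
proof -
  interpret prob_space \<mu> by fact
  have space: "space \<mu> = UNIV" using sets_eq_imp_space_eq[OF sets] by simp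
  note T_pow = measure_preserving_map_funpow[OF T]
  have T_meas: "T ^^ n \<in> measurable \<mu> \<mu>" for n
    using T_pow by (simp add: measure_preserving_map_def)
  have vimage_meas: "(T ^^ n) -` U \<in> events" if "U \<in> events" for n U
    using measurable_sets[OF T_meas that] by (simp add: space)
  have vimage_prob: "prob ((T ^^ n) -` U) = prob U" if "U \<in> events" for n U
    using measure_preserving_map_vimage[OF T_pow that] by (simp add: space)
  have ball: "ball x s \<in> events" for x s using sets by simp
  have A: "A i \<in> events" for i unfolding A_def by (intro vimage_meas ball)
  have prob_A: "prob (A i) = prob (ball (c i) (r i))" for i
    unfolding A_def by (intro vimage_prob ball)
  obtain Ca \<delta> where Ca: "0 < Ca" "0 < \<delta>"
    and annulus: "\<And>z s \<epsilon>. z \<in> Z \<Longrightarrow> 0 < s \<Longrightarrow> s \<le> r0 \<Longrightarrow> 0 < \<epsilon> \<Longrightarrow> \<epsilon> \<le> 1 \<Longrightarrow>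
      prob {x. s < dist x z \<and> dist x z < s + \<epsilon>} < Ca * \<epsilon> powr \<delta>"
    using cond_A unfolding condition_A_def by blast
  obtain d Cd \<alpha> where Cd: "0 < Cd" "0 < \<alpha>"
    and d: "\<And>n. n \<ge> 1 \<Longrightarrow> d n \<le> Cd * exp (- \<alpha> * real n powr inverse \<beta>)"
    and dec: "\<And>\<phi> \<psi> n. \<phi> \<in> lip_functions \<Longrightarrow> \<psi> \<in> lip_functions \<Longrightarrow> n \<ge> 1 \<Longrightarrow>
      \<bar>(\<integral>x. \<phi> ((T ^^ n) x) * \<psi> x \<partial>\<mu>) - (\<integral>x. \<phi> x \<partial>\<mu>) * (\<integral>x. \<psi> x \<partial>\<mu>)\<bar>
        \<le> d n * lip_norm \<phi> * lip_norm \<psi>"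
    using decay unfolding exp_decay_of_correlations_def by blast
  obtain i0 where i0: "\<And>i. i \<ge> i0 \<Longrightarrow> r i \<le> r0"
    using r(2) by (auto simp: eventually_sequentially)
  \<comment> \<open>An annulus of width \<open>n powr (- p)\<close> then has measure at most a
    multiple of \<open>n powr (- 2)\<close>.\<close>
  define p where "p = 2 / \<delta>"
  \<comment> \<open>Past a gap of \<open>(K * ln n) powr \<beta>\<close> the decay is at most
    \<open>Cd * n powr (- (2 + 2 * p))\<close>: the factor \<open>n powr (2 * p)\<close> from the
    two Lipschitz norms is cancelled and \<open>n powr (- 2)\<close> remains.\<close>
  define K where "K = (2 + 2 * p) / \<alpha>"
  \<comment> \<open>The three terms bound \<open>2 * e\<close>, \<open>e\<^sup>2\<close> and the
    decay error; the 9 comes from \<open>1 + 1 / \<epsilon> \<le> 3 * n powr p\<close>.\<close>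
  define D0 where "D0 = 2 * Ca + Ca\<^sup>2 + 9 * Cd"
  have p: "0 < p" using Ca by (simp add: p_def)
  have K: "0 < K" using p Cd by (simp add: K_def)
  have D0: "0 < D0" using Ca Cd by (simp add: D0_def add_pos_pos)
  define m where "m n = nat \<lceil>(K * ln (real n)) powr \<beta>\<rceil>" for n :: nat
  have var: "variance (\<lambda>x. \<Sum>i<n. indicat_real (A i) x) \<le> 2 * real (i0 + m n) * E n + D0"
    if n: "2 \<le> n" for n
  proof -
    \<comment> \<open>The half compensates for the annuli of width \<open>2 * \<epsilon>\<close> in
      the bump estimate.\<close>
    define \<epsilon> where "\<epsilon> = real n powr (- p) / 2"
    define e where "e = Ca * real n powr (- 2)"
    define D where "D = Cd * real n powr (- (2 + 2 * p))"
    define \<kappa> where "\<kappa> = D0 * real n powr (- 2)"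
    have n2: "real n powr (- 2) \<le> 1" using n powr_mono[of "-2" 0 "real n"] by simp
    have np: "1 \<le> real n powr p" using n p by (simp add: ge_one_powr_ge_zero)
    have ln_n: "0 < ln (real n)" using n by simp
    have \<epsilon>: "0 < \<epsilon>" "2 * \<epsilon> \<le> 1"
      using n p powr_mono[of "-p" 0 "real n"] by (auto simp: \<epsilon>_def)
    have \<kappa>_bound: "2 * e + e\<^sup>2 + D * (1 + 1 / \<epsilon>)\<^sup>2 \<le> \<kappa>"
    proof -
      have "e\<^sup>2 = Ca\<^sup>2 * (real n powr (- 2) * real n powr (- 2))"
        by (simp add: e_def power2_eq_square mult_ac)
      also have "\<dots> \<le> Ca\<^sup>2 * (real n powr (- 2) * 1)"
        using n2 by (intro mult_left_mono) auto
      finally have e2: "e\<^sup>2 \<le> Ca\<^sup>2 * real n powr (- 2)" by simp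
      have "1 / \<epsilon> = 2 * real n powr p" by (simp add: \<epsilon>_def powr_minus_divide)
      hence "(1 + 1 / \<epsilon>)\<^sup>2 \<le> (3 * real n powr p)\<^sup>2" using np by (intro power_mono) auto
      hence "D * (1 + 1 / \<epsilon>)\<^sup>2 \<le> D * (3 * real n powr p)\<^sup>2"
        using Cd by (intro mult_left_mono) (auto simp: D_def)
      also have "\<dots> = 9 * Cd * (real n powr (- (2 + 2 * p)) * real n powr p * real n powr p)"
        by (simp add: D_def power2_eq_square)
      also have "real n powr (- (2 + 2 * p)) * real n powr p * real n powr p = real n powr (- 2)"
        unfolding powr_add[symmetric] by simp
      finally show ?thesis using e2 unfolding \<kappa>_def D0_def e_def by (simp add: algebra_simps)
    qed
    have "variance (\<lambda>x. \<Sum>i<n. indicat_real (A i) x)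
        \<le> 2 * real (i0 + m n) * (\<Sum>i<n. prob (A i)) + (real n)\<^sup>2 * \<kappa>"
    proof (rule variance_sum_indicator_le[OF A])
      show "0 \<le> \<kappa>" using D0 by (simp add: \<kappa>_def)
      fix i j assume ij: "i0 \<le> i" "i + m n \<le> j" "j < n"
      define k where "k = j - i"
      have j: "j = k + i" and k: "m n \<le> k" using ij by (auto simp: k_def)
      have k_powr: "(K * ln (real n)) powr \<beta> \<le> real k"
        using k unfolding m_def by linarith
      have "0 < (K * ln (real n)) powr \<beta>" using K ln_n by simp
      \<comment> \<open>Decay of correlations is only available for positive times.\<close>
      hence k1: "1 \<le> k" using k_powr by linarith
      have "K * ln (real n) = ((K * ln (real n)) powr \<beta>) powr inverse \<beta>"
        using K ln_n \<beta> by (simp add: powr_powr)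
      also have "\<dots> \<le> real k powr inverse \<beta>"
        using k_powr \<beta> by (intro powr_mono2) auto
      finally have "\<alpha> * (K * ln (real n)) \<le> \<alpha> * real k powr inverse \<beta>"
        using Cd by (intro mult_left_mono) auto
      moreover have \<alpha>K: "\<alpha> * (K * ln (real n)) = (2 + 2 * p) * ln (real n)"
        using Cd by (simp add: K_def)
      ultimately have "exp (- \<alpha> * real k powr inverse \<beta>) \<le> exp (- (2 + 2 * p) * ln (real n))"
        using \<alpha>K by (simp only: exp_le_cancel_iff mult_minus_left)
      also have "\<dots> = real n powr (- (2 + 2 * p))" using n by (simp add: powr_def)
      finally have "Cd * exp (- \<alpha> * real k powr inverse \<beta>) \<le> D"
        unfolding D_def using Cd by (intro mult_left_mono) auto
      hence dk: "d k \<le> D" using d[OF k1] by linarith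
      \<comment> \<open>By invariance of the measure, only the time difference \<open>k\<close>
        matters for the correlation.\<close>
      have "A i \<inter> A j = (T ^^ i) -` (ball (c i) (r i) \<inter> (T ^^ k) -` ball (c j) (r j))"
        by (auto simp: A_def j funpow_add)
      hence "prob (A i \<inter> A j) = prob (ball (c i) (r i) \<inter> (T ^^ k) -` ball (c j) (r j))"
        by (simp only: vimage_prob vimage_meas ball sets.Int)
      also have "\<dots> \<le> prob (ball (c i) (r i)) * prob (ball (c j) (r j))
          + (2 * e + e\<^sup>2 + D * (1 + 1 / \<epsilon>)\<^sup>2)"
      proof (rule correlation_balls_le[OF \<open>prob_space \<mu>\<close> sets T_meas])
        show "0 < r i" "0 < r j" "r i \<le> r0" "r j \<le> r0" using r(1) i0 ij by auto
        show "0 < \<epsilon>" by fact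
        show "0 \<le> D" using Cd by (simp add: D_def)
      next
        fix z s assume z: "z \<in> {c i, c j}" and s: "0 < s" "s \<le> r0"
        have "(2 * \<epsilon>) powr \<delta> = real n powr (- 2)" using Ca by (simp add: \<epsilon>_def powr_powr p_def)
        thus "prob {w. s < dist w z \<and> dist w z < s + 2 * \<epsilon>} \<le> e"
          using annulus[of z s "2 * \<epsilon>"] z s c \<epsilon> by (auto simp: e_def)
      next
        fix \<phi> \<psi> :: "'a \<Rightarrow> real" assume lip: "\<phi> \<in> lip_functions" "\<psi> \<in> lip_functions"
        have "d k * lip_norm \<phi> * lip_norm \<psi> \<le> D * lip_norm \<phi> * lip_norm \<psi>"
          using dk lip by (intro mult_right_mono lip_norm_nonneg)
        thus "\<bar>(\<integral>w. \<phi> ((T ^^ k) w) * \<psi> w \<partial>\<mu>) - (\<integral>w. \<phi> w \<partial>\<mu>) * (\<integral>w. \<psi> w \<partial>\<mu>)\<bar>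
            \<le> D * lip_norm \<phi> * lip_norm \<psi>"
          using dec[OF lip k1] by linarith
      qed
      finally show "prob (A i \<inter> A j) \<le> prob (A i) * prob (A j) + \<kappa>"
        using \<kappa>_bound by (simp add: prob_A)
    qed
    also have "(real n)\<^sup>2 * \<kappa> = D0"
      using n powr_realpow[of "real n" 2] by (simp add: \<kappa>_def powr_minus)
    finally show ?thesis by (simp add: prob_A E_def)
  qed
  \<comment> \<open>Once \<open>ln n powr \<beta>\<close> and \<open>E n\<close> are at least 1, the
    constants \<open>i0\<close>, \<open>D0\<close> and the rounding error 1 in \<open>m n\<close>
    are all absorbed into their product.\<close>
  define V where "V = 2 * real i0 + 2 * K powr \<beta> + 2 + D0"
  have "0 < V" using D0 by (simp add: V_def add_nonneg_pos)
  moreover have "\<forall>\<^sub>F n in sequentially. variance (\<lambda>x. \<Sum>i<n. indicat_real (A i) x)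
      \<le> V * ln (real n) powr \<beta> * E n"
  proof -
    have "\<forall>\<^sub>F n::nat in sequentially. 1 \<le> ln (real n)" by real_asymp
    moreover have "\<forall>\<^sub>F n in sequentially. 1 \<le> E n" using E by (auto simp: filterlim_at_top)
    ultimately show ?thesis using eventually_ge_at_top[of 2]
    proof eventually_elim
      case (elim n)
      define L where "L = ln (real n) powr \<beta>"
      have L: "1 \<le> L" using elim \<beta> by (simp add: L_def ge_one_powr_ge_zero)
      have "real (m n) \<le> (K * ln (real n)) powr \<beta> + 1"
        unfolding m_def using powr_ge_zero[of "K * ln (real n)" \<beta>] by linarith
      also have "(K * ln (real n)) powr \<beta> = K powr \<beta> * L"
        using K elim by (simp add: L_def powr_mult)
      finally have "2 * real (i0 + m n) * E n + D0 \<le> 2 * (real i0 + (K powr \<beta> * L + 1)) * E n + D0"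
        using elim by (intro add_mono mult_right_mono mult_left_mono) auto
      also have "\<dots> \<le> 2 * (real i0 * L + (K powr \<beta> * L + L)) * E n + D0 * (L * E n)"
      proof (intro add_mono mult_right_mono mult_left_mono)
        show "real i0 \<le> real i0 * L" using L mult_left_mono[of 1 L "real i0"] by simp
        have "1 * 1 \<le> L * E n" using L elim by (intro mult_mono) auto
        thus "D0 \<le> D0 * (L * E n)" using D0 mult_left_mono[of 1 "L * E n" D0] by simp
      qed (use L elim in auto)
      also have "\<dots> = V * L * E n" by (simp add: V_def algebra_simps)
      finally show ?case using var[of n] elim by (simp add: L_def)
    qed
  qed
  ultimately show ?thesis by (rule that)
qed

section \<open>The strong law for visits to the balls\<close>

theorem corollary5:
  fixes \<mu> :: "'a::metric_space measure"
    and T :: "'a \<Rightarrow> 'a"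
    and c :: "nat \<Rightarrow> 'a"
    and r :: "nat \<Rightarrow> real"
    and B :: "nat \<Rightarrow> 'a set"
    and r0 \<beta> \<gamma> :: real
  assumes "prob_space \<mu>"
    and "sets \<mu> = sets borel"
    and "measure_preserving_map \<mu> T"
    and "\<And>i. 0 < r i"
    and "\<And>i. B i = ball (c i) (r i)"
    and "condition_A \<mu> (required_centres c r) r0"
    and "\<forall>\<^sub>F i in sequentially. r i \<le> r0"
    and "0 < \<beta>"
    and "1 < \<gamma>"
    and "\<forall>\<^sub>F i in sequentially.
           measure \<mu> (B i) \<ge>
             inverse (real i) * ln (real i) powr (\<beta> - 1) * ln (ln (real i))
               * ln (ln (ln (real i))) powr \<gamma>"
    and "exp_decay_of_correlations T \<mu> (inverse \<beta>)"
  shows "AE x in \<mu>.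
           (\<lambda>n. (\<Sum>i<n. indicator (B i) ((T ^^ i) x)) / (\<Sum>i<n. measure \<mu> (B i)))
             \<longlonglongrightarrow> (1 :: real)"
proof -
  interpret prob_space \<mu> by fact
  have space: "space \<mu> = UNIV" using sets_eq_imp_space_eq[OF assms(2)] by simp
  define A where "A i = (T ^^ i) -` B i" for i
  define E where "E n = (\<Sum>i<n. measure \<mu> (B i))" for n
  note T_pow = measure_preserving_map_funpow[OF assms(3)]
  have B: "B i \<in> events" for i using assms(2,5) by simp
  have A: "A i \<in> events" for i
    using measurable_sets[of "T ^^ i" \<mu> \<mu> "B i"] T_pow[of i] B
    by (simp add: A_def space measure_preserving_map_def)
  have prob_A: "prob (A i) = measure \<mu> (B i)" for i
    using measure_preserving_map_vimage[OF T_pow B] by (simp add: A_def space)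
  \<comment> \<open>In the nested concentric case all centres equal \<open>c 0\<close>, so condition
    (A) is available at every centre that occurs.\<close>
  have centres: "c i \<in> required_centres c r" for i
    by (auto simp: required_centres_def)
  have "0 < \<gamma>" using assms(9) by simp
  then obtain a where a: "0 < a" and growth: "\<forall>\<^sub>F n in sequentially.
      a * ln (real n) powr \<beta> * ln (ln (real n)) * ln (ln (ln (real n))) powr \<gamma> \<le> E n"
    unfolding E_def by (rule sum_log_growth[OF _ measure_nonneg assms(10)])
  have "filterlim (\<lambda>n. a * ln (real n) powr \<beta> * ln (ln (real n)) * ln (ln (ln (real n))) powr \<gamma>)
      at_top sequentially"
    using a \<open>0 < \<beta>\<close> \<open>0 < \<gamma>\<close> by real_asymp
  hence E: "filterlim E at_top sequentially" using growth by (rule filterlim_at_top_mono)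
  obtain V where V: "0 < V" and var: "\<forall>\<^sub>F n in sequentially.
      variance (\<lambda>x. \<Sum>i<n. indicat_real (A i) x) \<le> V * ln (real n) powr \<beta> * E n"
    using variance_visits_le[where c=c, OF assms(1-3) assms(4,7,6) centres assms(8,11)] E
    unfolding E_def A_def assms(5) by blast
  obtain C where C: "0 < C"
    and rate: "\<forall>\<^sub>F n in sequentially. ln (real n) powr \<beta> \<le> C * chebyshev_rate \<gamma> (E n) * E n"
    using growth_imp_chebyshev_rate[OF \<open>0 < \<beta>\<close> \<open>0 < \<gamma>\<close> a E growth] by blast
  \<comment> \<open>The variance bound \<open>V * ln n powr \<beta> * E n\<close> combined with the
    rate bound on \<open>ln n powr \<beta>\<close> produces the square of \<open>E n\<close> that
    Chebyshev's inequality divides out.\<close>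
  define \<rho> where "\<rho> y = V * C * chebyshev_rate \<gamma> y" for y
  have "AE x in \<mu>. (\<lambda>n. (\<Sum>i<n. indicat_real (A i) x) / (\<Sum>i<n. prob (A i))) \<longlonglongrightarrow> 1"
  proof (rule strong_law_of_variance_bound[OF A])
    show "filterlim (\<lambda>n. \<Sum>i<n. prob (A i)) at_top sequentially"
      using E by (simp add: prob_A E_def[abs_def])
    have "\<forall>\<^sub>F n in sequentially. variance (\<lambda>x. \<Sum>i<n. indicat_real (A i) x) \<le> \<rho> (E n) * (E n)\<^sup>2"
      using var rate
    proof eventually_elim
      case (elim n)
      have "0 \<le> E n" by (simp add: E_def sum_nonneg)
      hence "V * ln (real n) powr \<beta> * E n \<le> V * (C * chebyshev_rate \<gamma> (E n) * E n) * E n"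
        using elim V by (intro mult_right_mono mult_left_mono) auto
      thus ?case using elim by (simp add: \<rho>_def power2_eq_square mult_ac)
    qed
    thus "\<forall>\<^sub>F n in sequentially. variance (\<lambda>x. \<Sum>i<n. indicat_real (A i) x)
        \<le> \<rho> (\<Sum>i<n. prob (A i)) * (\<Sum>i<n. prob (A i))\<^sup>2"
      by (simp add: prob_A E_def)
    show "antimono_on {exp 2..} \<rho>"
      using antimono_chebyshev_rate[OF \<open>0 < \<gamma>\<close>] V C unfolding \<rho>_def
      by (auto simp: monotone_on_def intro!: mult_left_mono)
    show "summable (\<lambda>k. \<rho> (q ^ k))" if "1 < q" for q
      unfolding \<rho>_def by (intro summable_mult summable_chebyshev_rate assms(9) that)
  qed
  moreover have "indicat_real (A i) x = indicator (B i) ((T ^^ i) x)" for i x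
    by (simp add: A_def indicator_def)
  ultimately show ?thesis by (simp add: prob_A)
qed

end
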